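(* For every integer $d\ge 1$ there exists a $d$-maximal set $S\subset[2]^\infty$ with $|S|>\binom{\lfloor 3d/2\rfloor}{d}$. Moreover, $\binom{\lfloor 3d/2\rfloor}{d}\ge (2.59+o(1))^d$ as $d\to\infty$.
   Context: $[2]=\{1,2\}$ and $[2]^\infty$ is the set of infinite sequences over $[2]$. The Hamming distance is $\mathrm{dist}(a,b)=|\{i:a_i\ne b_i\}|$, and $\mathrm{diam}(S)=\sup_{a,b\in S}\mathrm{dist}(a,b)$. A set $S\subset[2]^\infty$ is $d$-maximal if $\mathrm{diam}(S)=d$ and $S$ is inclusion-maximal among subsets of $[2]^\infty$ of diameter $d$. *)

theory Defs
  imports Complex_Main "HOL-Library.Extended_Nat"
begin

definition seqs2 :: "(nat \<Rightarrow> nat) set" where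
  "seqs2 = {a. \<forall>i. a i \<in> {1, 2}}"

definition hamming_dist :: "(nat \<Rightarrow> nat) \<Rightarrow> (nat \<Rightarrow> nat) \<Rightarrow> enat" where
  "hamming_dist a b = (if finite {i. a i \<noteq> b i} then enat (card {i. a i \<noteq> b i}) else \<infinity>)"

definition hamming_diam :: "(nat \<Rightarrow> nat) set \<Rightarrow> enat" where
  "hamming_diam S = (SUP a\<in>S. SUP b\<in>S. hamming_dist a b)"

definition d_maximal :: "nat \<Rightarrow> (nat \<Rightarrow> nat) set \<Rightarrow> bool" where
  "d_maximal d S \<longleftrightarrow> S \<subseteq> seqs2 \<and> hamming_diam S = enat d \<and>
     (\<forall>T. T \<subseteq> seqs2 \<and> hamming_diam T = enat d \<and> S \<subseteq> T \<longrightarrow> T = S)"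

end

theory Submission
  imports Defs
begin

text \<open>
  Identify a sequence with the set of positions of the letter 2. With \<open>n = 3 * d div 2\<close>, the
  \<open>d\<close>-subsets of \<open>{..<n}\<close> together with the empty set have diameter \<open>d\<close>, and any set within
  distance \<open>d\<close> of all of them lies inside \<open>{..<n}\<close>. So only finitely many sets of diameter \<open>d\<close>
  extend this family, and a largest one is finite and \<open>d\<close>-maximal.
  For the growth rate, consecutive quotients of \<open>3 * k choose k\<close> tend to \<open>27 / 4 > 2.59\<^sup>2\<close>;
  hence the bound even holds with \<open>\<epsilon> = 0\<close>.
\<close>

section \<open>Sequences over {1, 2} as sets of positions\<close>

definition seq_of :: "nat set \<Rightarrow> nat \<Rightarrow> nat" where
  "seq_of A = (\<lambda>i. if i \<in> A then 2 else 1)"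

lemma seq_of_in_seqs2: "seq_of A \<in> seqs2"
  by (simp add: seq_of_def seqs2_def)

lemma seqs2_eq_range: "seqs2 = range seq_of"
proof
  show "seqs2 \<subseteq> range seq_of"
  proof
    fix a assume "a \<in> seqs2"
    then have "a = seq_of {i. a i = 2}"
      by (auto simp: seqs2_def seq_of_def fun_eq_iff)
    then show "a \<in> range seq_of" by blast
  qed
qed (auto simp: seq_of_in_seqs2)

lemma inj_seq_of: "inj seq_of"
  by (rule injI) (auto simp: seq_of_def fun_eq_iff set_eq_iff split: if_splits)

lemma seq_of_neq_set: "{i. seq_of A i \<noteq> seq_of B i} = (A - B) \<union> (B - A)"
  by (auto simp: seq_of_def)

text \<open>The finiteness condition stays explicit because \<open>card\<close> of an infinite set
  is 0, so the cardinality bound alone would also accept pairs at infinite distance.\<close>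

lemma hamming_dist_seq_of_le_iff:
  "hamming_dist (seq_of A) (seq_of B) \<le> enat d \<longleftrightarrow>
     finite ((A - B) \<union> (B - A)) \<and> card ((A - B) \<union> (B - A)) \<le> d"
  unfolding hamming_dist_def seq_of_neq_set by auto

lemma hamming_diam_le_iff:
  "hamming_diam S \<le> enat d \<longleftrightarrow> (\<forall>a\<in>S. \<forall>b\<in>S. hamming_dist a b \<le> enat d)"
  unfolding hamming_diam_def by (simp add: SUP_le_iff)

lemma hamming_dist_le_diam: "a \<in> S \<Longrightarrow> b \<in> S \<Longrightarrow> hamming_dist a b \<le> hamming_diam S"
  unfolding hamming_diam_def by (meson SUP_upper2 SUP_upper)

section \<open>A finite family of diameter d and the sets close to it\<close>

lemma card_symdiff:
  assumes "finite A" "finite B"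
  shows "card ((A - B) \<union> (B - A)) + 2 * card (A \<inter> B) = card A + card B"
proof -
  have "card A = card (A - B) + card (A \<inter> B)" "card B = card (B - A) + card (A \<inter> B)"
    using card_Diff_subset_Int[of A B] card_Diff_subset_Int[of B A] assms
    by (simp_all add: Int_commute card_mono)
  moreover have "card ((A - B) \<union> (B - A)) = card (A - B) + card (B - A)"
    using assms by (intro card_Un_disjoint) auto
  ultimately show ?thesis by simp
qed

text \<open>The member \<open>{}\<close> does two jobs: it bounds the size of every set close to the
  family by d, and it supplies the one extra element that makes the final inequality strict.\<close>

definition base_family :: "nat \<Rightarrow> nat set set" where
  "base_family d = insert {} {D. D \<subseteq> {..<3 * d div 2} \<and> card D = d}"

lemma card_base_family:
  assumes "d \<ge> 1"
  shows "finite (base_family d)" "card (base_family d) = ((3 * d div 2) choose d) + 1"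
proof -
  have "finite {D. D \<subseteq> {..<3 * d div 2} \<and> card D = d}" by simp
  then show "finite (base_family d)" "card (base_family d) = ((3 * d div 2) choose d) + 1"
    using assms n_subsets[of "{..<3 * d div 2}" d] by (auto simp: base_family_def)
qed

text \<open>Two d-subsets of an n-element set share at least 2d - n elements. With n = d + d div 2
  their symmetric difference has size at most 2(n - d) = 2(d div 2) \<le> d.\<close>

lemma base_family_symdiff_le:
  assumes "A \<in> base_family d" "B \<in> base_family d"
  shows "finite ((A - B) \<union> (B - A)) \<and> card ((A - B) \<union> (B - A)) \<le> d"
proof -
  have fin: "finite A" "finite B"
    using assms finite_subset by (auto simp: base_family_def)
  consider "A = {}" | "B = {}"
    | "A \<subseteq> {..<3 * d div 2}" "B \<subseteq> {..<3 * d div 2}" "card A = d" "card B = d"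
    using assms by (auto simp: base_family_def)
  then have "card ((A - B) \<union> (B - A)) \<le> d"
  proof cases
    case 3
    have "card (A \<union> B) \<le> card {..<3 * d div 2}" using 3 by (intro card_mono) auto
    moreover have "card (A \<union> B) + card (A \<inter> B) = 2 * d"
      using card_Un_Int[OF fin] 3 by simp
    ultimately show ?thesis using card_symdiff[OF fin] 3 by simp
  qed (use assms in \<open>auto simp: base_family_def\<close>)
  with fin show ?thesis by simp
qed

text \<open>Closeness to a d-subset D amounts to |U| \<le> 2|U \<inter> D|. The proof tests this
  against a D that meets U as little as possible.\<close>

lemma close_to_base_family_subset:
  assumes close: "\<And>D. D \<in> base_family d \<Longrightarrow>
      finite ((U - D) \<union> (D - U)) \<and> card ((U - D) \<union> (D - U)) \<le> d"
  shows "U \<subseteq> {..<3 * d div 2}"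
proof -
  define N where "N = {..<3 * d div 2}"
  define m where "m = d div 2"
  have N: "finite N" "card N = d + m" by (auto simp: N_def m_def)
  have U: "finite U" "card U \<le> d" using close[of "{}"] by (auto simp: base_family_def)
  have half: "card U \<le> 2 * card (U \<inter> D)" if "D \<subseteq> N" "card D = d" for D
  proof -
    have "card ((U - D) \<union> (D - U)) \<le> d"
      using close[of D] that by (auto simp: base_family_def N_def)
    moreover have "finite D" using that N finite_subset by blast
    ultimately show ?thesis using card_symdiff[OF U(1), of D] that by simp
  qed
  have Usplit: "card U = card (U \<inter> N) + card (U - N)"
    using card_Int_Diff[OF U(1)] .
  have Nsplit: "card N = card (N \<inter> U) + card (N - U)"
    using card_Int_Diff[OF N(1)] .
  have "U - N = {}"
  \<comment> \<open>Since |N| = d + m, this case split decides whether N - U has room for d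
    elements, that is, whether D can avoid U altogether; if it can, \<open>half\<close> forces U to
    be empty.\<close>
  proof (cases "card (U \<inter> N) \<le> m")
    case True
    then have "d \<le> card (N - U)" using Nsplit N by (simp add: Int_commute)
    then obtain D where D: "D \<subseteq> N - U" "card D = d"
      by (meson obtain_subset_with_card_n)
    moreover from D have "U \<inter> D = {}" by blast
    ultimately show ?thesis using half[of D] U by auto
  next
    case False
    have "card (N - U) \<le> d" using False Nsplit N by (simp add: Int_commute)
    moreover have "N - U \<subseteq> N" "d \<le> card N" using N by auto
    \<comment> \<open>Now D must meet U, so it uses up all of N - U first. This gives |U \<inter> D|
      = d - |N - U| = |U \<inter> N| - m.\<close>
    ultimately obtain D where D: "N - U \<subseteq> D" "D \<subseteq> N" "card D = d"
      using exists_subset_between[of "N - U" d N] N by auto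
    have "finite D" using D N finite_subset by blast
    moreover have "D - U = N - U" using D by blast
    ultimately have "d = card (D \<inter> U) + card (N - U)"
      using card_Int_Diff[of D U] D by simp
    \<comment> \<open>From \<open>half\<close>, |U \<inter> N| + |U - N| \<le> 2|U \<inter> N| - 2m,
      hence |U - N| + 2m \<le> |U \<inter> N| \<le> d - |U - N|. As 2m \<ge> d - 1, this leaves 2|U
      - N| \<le> 1.\<close>
    then have "2 * card (U - N) + 2 * m \<le> d"
      using half[OF D(2,3)] Usplit Nsplit N U by (simp add: Int_commute)
    then have "card (U - N) = 0" by (simp add: m_def)
    then show ?thesis using U by simp
  qed
  then show ?thesis by (auto simp: N_def)
qed

lemma hamming_diam_base_family:
  assumes "d \<ge> 1"
  shows "hamming_diam (seq_of ` base_family d) = enat d"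
proof (rule antisym)
  show "hamming_diam (seq_of ` base_family d) \<le> enat d"
    by (auto simp: hamming_diam_le_iff hamming_dist_seq_of_le_iff dest: base_family_symdiff_le)
  have "{..<d} \<in> base_family d" "{} \<in> base_family d" by (auto simp: base_family_def)
  then have "hamming_dist (seq_of {}) (seq_of {..<d}) \<le> hamming_diam (seq_of ` base_family d)"
    by (intro hamming_dist_le_diam) auto
  then show "enat d \<le> hamming_diam (seq_of ` base_family d)"
    by (simp add: hamming_dist_def seq_of_neq_set)
qed

lemma diam_extension_of_base_family:
  assumes "T \<subseteq> seqs2" "hamming_diam T = enat d" "seq_of ` base_family d \<subseteq> T"
  shows "T \<subseteq> seq_of ` Pow {..<3 * d div 2}"
proof
  fix x assume x: "x \<in> T"
  then obtain U where U: "x = seq_of U" using assms(1) seqs2_eq_range by auto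
  have "U \<subseteq> {..<3 * d div 2}"
  proof (rule close_to_base_family_subset)
    fix D assume "D \<in> base_family d"
    then have "hamming_dist (seq_of U) (seq_of D) \<le> enat d"
      using hamming_dist_le_diam[of x T "seq_of D"] x U assms by auto
    then show "finite ((U - D) \<union> (D - U)) \<and> card ((U - D) \<union> (D - U)) \<le> d"
      by (simp only: hamming_dist_seq_of_le_iff)
  qed
  then show "x \<in> seq_of ` Pow {..<3 * d div 2}" using U by blast
qed

lemma large_d_maximal_exists:
  assumes "d \<ge> 1"
  shows "\<exists>S. d_maximal d S \<and> card S > (3 * d div 2) choose d"
proof -
  define S0 where "S0 = seq_of ` base_family d"
  define X where "X = seq_of ` Pow {..<3 * d div 2}"
  define F where "F = {T. T \<subseteq> seqs2 \<and> hamming_diam T = enat d \<and> S0 \<subseteq> T}"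
  have FX: "F \<subseteq> Pow X"
    using diam_extension_of_base_family by (auto simp: F_def S0_def X_def)
  have finX: "finite X" by (simp add: X_def)
  have "S0 \<in> F"
    using hamming_diam_base_family[OF assms] by (auto simp: F_def S0_def seq_of_in_seqs2)
  moreover have "finite F" using FX finX finite_subset by blast
  ultimately obtain S where S: "S \<in> F" "\<And>T. T \<in> F \<Longrightarrow> S \<subseteq> T \<Longrightarrow> S = T"
    using finite_has_maximal[of F] by blast
  have "d_maximal d S"
    unfolding d_maximal_def
  proof (intro conjI allI impI)
    \<comment> \<open>A competitor T containing S also contains \<open>S0\<close>, so it lies in
      \<open>F\<close>; maximality within \<open>F\<close> is therefore maximality among all sets of
      diameter d.\<close>
    show "T = S" if "T \<subseteq> seqs2 \<and> hamming_diam T = enat d \<and> S \<subseteq> T" for T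
      using S(2)[of T] S(1) that by (auto simp: F_def)
  qed (use S(1) in \<open>auto simp: F_def\<close>)
  moreover have "card S0 \<le> card S"
  proof (rule card_mono)
    \<comment> \<open>Finiteness is essential to the claim: \<open>card\<close> would be 0 on an
      infinite set.\<close>
    show "finite S" using S(1) FX finX finite_subset by blast
    show "S0 \<subseteq> S" using S(1) by (simp add: F_def)
  qed
  moreover have "card S0 = ((3 * d div 2) choose d) + 1"
    unfolding S0_def using card_base_family[OF assms] inj_seq_of
    by (simp add: card_image inj_on_subset)
  ultimately show ?thesis by (intro exI[of _ S]) simp
qed

section \<open>Exponential growth of the binomial coefficients\<close>

text \<open>The quotient of consecutive terms with denominators cleared; the factor 3k + 3 over k +
  1 has been reduced to 3.\<close>

lemma choose_3k_Suc:
  "((3 * Suc k) choose Suc k) * ((2 * k + 2) * (2 * k + 1))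
     = ((3 * k) choose k) * (3 * (3 * k + 2) * (3 * k + 1))"
proof -
  have f: "fact (3 * Suc k) = (3 * k + 3) * ((3 * k + 2) * ((3 * k + 1) * (fact (3 * k) :: nat)))"
    by (simp add: numeral_3_eq_3)
  have g: "fact (2 * Suc k) = (2 * k + 2) * ((2 * k + 1) * (fact (2 * k) :: nat))"
    by (simp add: numeral_2_eq_2)
  have 1: "fact (Suc k) * fact (2 * Suc k) * ((3 * Suc k) choose Suc k) = (fact (3 * Suc k) :: nat)"
    using binomial_fact_lemma[of "Suc k" "3 * Suc k"] by (simp del: fact_Suc)
  have 2: "fact k * fact (2 * k) * ((3 * k) choose k) = (fact (3 * k) :: nat)"
    using binomial_fact_lemma[of k "3 * k"] by simp
  \<comment> \<open>Multiplied by this common factor, both sides become (3k + 3)!, and the factor is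
    cancelled at the end.\<close>
  have "(fact k * fact (2 * k) * (k + 1)) * (((3 * Suc k) choose Suc k) * ((2 * k + 2) * (2 * k + 1)))
      = fact (Suc k) * fact (2 * Suc k) * ((3 * Suc k) choose Suc k)"
    unfolding g fact_Suc[of k] by (simp del: mult_Suc_right mult_Suc binomial_Suc_Suc add: mult_ac)
  also have "\<dots> = (3 * k + 3) * ((3 * k + 2) * ((3 * k + 1) * fact (3 * k)))"
    unfolding 1 f ..
  also have "\<dots> = (fact k * fact (2 * k) * (k + 1)) * (((3 * k) choose k) * (3 * (3 * k + 2) * (3 * k + 1)))"
    unfolding 2[symmetric] by algebra
  finally show ?thesis by (subst (asm) mult_cancel1) simp
qed

text \<open>The constant 6.71 is chosen strictly between \<open>2.59 ^ 2\<close> = 6.7081 and the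
  limit 27/4 = 6.75 of the quotients. The threshold 100 lies beyond the positive root (about 83.4)
  of the quadratic 16x^2 - 1326x - 742 that arises.\<close>

lemma choose_3k_growth:
  assumes "k \<ge> 100"
  shows "6.71 * real ((3 * k) choose k) \<le> real ((3 * Suc k) choose Suc k)"
proof -
  define x where "x = real k"
  have x: "x \<ge> 100" using assms by (simp add: x_def)
  define p where "p = (2 * x + 2) * (2 * x + 1)"
  have p: "p > 0" using x by (simp add: p_def)
  have "100 * x \<le> x * x" using x by (intro mult_right_mono) auto
  moreover have "100 * (3 * (3 * x + 2) * (3 * x + 1) - 6.71 * p) = 16 * (x * x) - 1326 * x - 742"
    by (simp add: p_def field_simps)
  ultimately have "0 \<le> 100 * (3 * (3 * x + 2) * (3 * x + 1) - 6.71 * p)"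
    using x by linarith
  then have "6.71 * p \<le> 3 * (3 * x + 2) * (3 * x + 1)"
    by simp
  then have "real ((3 * k) choose k) * (6.71 * p)
      \<le> real ((3 * k) choose k) * (3 * (3 * x + 2) * (3 * x + 1))"
    by (intro mult_left_mono) auto
  also have "\<dots> = real ((3 * Suc k) choose Suc k) * p"
    using arg_cong[OF choose_3k_Suc[of k], of real]
    unfolding p_def x_def by (simp only: of_nat_mult of_nat_add of_nat_numeral of_nat_1)
  finally have "(6.71 * real ((3 * k) choose k)) * p \<le> real ((3 * Suc k) choose Suc k) * p"
    by (simp only: mult_ac)
  then show ?thesis using p by (simp only: mult_le_cancel_right_pos)
qed

text \<open>The factor \<open>6.71 ^ 100\<close> absorbs the start of the induction, where it
  suffices that the binomial coefficient is at least 1.\<close>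

lemma choose_3k_lower:
  assumes "k \<ge> 100"
  shows "(6.71::real) ^ k \<le> 6.71 ^ 100 * real ((3 * k) choose k)"
  using assms
proof (induction k rule: dec_induct)
  case base
  have "0 < (3 * 100::nat) choose 100" by (rule zero_less_binomial) simp
  then have "1 \<le> real ((3 * 100) choose 100)" by linarith
  then show ?case using mult_left_mono[of 1 "real ((3 * 100) choose 100)" "6.71 ^ 100"] by simp
next
  case (step k)
  have "(6.71::real) ^ Suc k = 6.71 * 6.71 ^ k" by simp
  also have "\<dots> \<le> 6.71 * (6.71 ^ 100 * real ((3 * k) choose k))"
    using step.IH by (intro mult_left_mono) auto
  also have "\<dots> = 6.71 ^ 100 * (6.71 * real ((3 * k) choose k))" by (simp only: mult_ac)
  also have "\<dots> \<le> 6.71 ^ 100 * real ((3 * Suc k) choose Suc k)"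
    using choose_3k_growth[OF step.hyps(1)] by (intro mult_left_mono) auto
  finally show ?case .
qed

text \<open>The gap between \<open>2.59 ^ 2\<close> and 6.71 beats any constant factor: it pays for
  \<open>6.71 ^ 100\<close> and leaves a spare factor 2.59, which is needed for odd d.\<close>

lemma eventually_choose_3k_ge:
  "\<forall>\<^sub>F k in sequentially. 2.59 * (2.59 ^ 2) ^ k \<le> real ((3 * k) choose k)"
proof -
  define c :: real where "c = 6.71 ^ 100"
  define q :: real where "q = 2.59 ^ 2"
  have c: "c > 0" by (simp add: c_def)
  have q: "0 < q" "q < 6.71" by (simp_all add: q_def power2_eq_square)
  obtain n where n: "c * 2.59 < (6.71 / q) ^ n"
    using real_arch_pow[of "6.71 / q" "c * 2.59"] q by auto
  have "c * 2.59 \<le> (6.71 / q) ^ k" if "k \<ge> n" for k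
  proof -
    have "1 \<le> 6.71 / q" using q by simp
    from power_increasing[OF that this] n show ?thesis by linarith
  qed
  then have "\<forall>\<^sub>F k in sequentially. c * 2.59 \<le> (6.71 / q) ^ k"
    by (auto simp: eventually_sequentially)
  then have "\<forall>\<^sub>F k in sequentially. 2.59 * q ^ k \<le> real ((3 * k) choose k)"
    using eventually_ge_at_top[of 100]
  proof eventually_elim
    case (elim k)
    have "c * (2.59 * q ^ k) \<le> 6.71 ^ k"
      using elim(1) q by (simp add: power_divide field_simps)
    also have "\<dots> \<le> c * real ((3 * k) choose k)"
      using choose_3k_lower[OF elim(2)] by (simp only: c_def)
    finally show ?case using c by (simp only: mult_le_cancel_left_pos)
  qed
  then show ?thesis by (simp only: q_def)
qed

text \<open>With k = d div 2 the upper index on the right is d + k \<ge> 3k, and by symmetry the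
  lower index d may be replaced by k. This reduces all d to the terms with upper index 3k.\<close>

lemma choose_3k_le_choose_d:
  "(3 * (d div 2)) choose (d div 2) \<le> (3 * d div 2) choose d"
proof -
  define k where "k = d div 2"
  have n: "3 * d div 2 = d + k" by (simp add: k_def)
  have "(3 * k) choose k \<le> (d + k) choose k"
    by (intro binomial_right_mono) (simp add: k_def)
  also have "\<dots> = (d + k) choose d"
    using binomial_symmetric[of k "d + k"] by simp
  finally show ?thesis unfolding n k_def .
qed

lemma eventually_choose_ge_power:
  "\<forall>\<^sub>F d in sequentially. (2.59::real) ^ d \<le> real ((3 * d div 2) choose d)"
proof -
  have "filterlim (\<lambda>d::nat. d div 2) at_top sequentially"
    unfolding filterlim_at_top
  proof
    fix Z :: nat
    show "\<forall>\<^sub>F d in sequentially. Z \<le> d div 2"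
      using eventually_ge_at_top[of "2 * Z"] by eventually_elim simp
  qed
  then have "\<forall>\<^sub>F d in sequentially. 2.59 * (2.59 ^ 2) ^ (d div 2)
      \<le> real ((3 * (d div 2)) choose (d div 2))"
    using eventually_choose_3k_ge by (rule eventually_compose_filterlim[rotated])
  then show ?thesis
  proof eventually_elim
    case (elim d)
    \<comment> \<open>Here the spare factor is spent: d is at most 2(d div 2) + 1, with equality for
      odd d.\<close>
    have "(2.59::real) ^ d \<le> 2.59 ^ Suc (2 * (d div 2))"
      by (intro power_increasing) auto
    also have "\<dots> = 2.59 * (2.59 ^ 2) ^ (d div 2)" by (simp only: power_Suc power_mult)
    also note elim
    also have "real ((3 * (d div 2)) choose (d div 2)) \<le> real ((3 * d div 2) choose d)"
      using choose_3k_le_choose_d by (simp only: of_nat_le_iff)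
    finally show ?case .
  qed
qed

theorem theorem2:
  shows "(\<forall>d::nat. d \<ge> 1 \<longrightarrow> (\<exists>S. d_maximal d S \<and> card S > (3 * d div 2) choose d)) \<and>
    (\<exists>\<epsilon> :: nat \<Rightarrow> real. \<epsilon> \<longlonglongrightarrow> 0 \<and>
      (\<forall>\<^sub>F d in sequentially. real ((3 * d div 2) choose d) \<ge> (2.59 + \<epsilon> d) ^ d))"
proof (intro conjI allI impI)
  show "\<exists>S. d_maximal d S \<and> card S > (3 * d div 2) choose d" if "d \<ge> 1" for d
    using large_d_maximal_exists[OF that] .
  show "\<exists>\<epsilon> :: nat \<Rightarrow> real. \<epsilon> \<longlonglongrightarrow> 0 \<and>
      (\<forall>\<^sub>F d in sequentially. real ((3 * d div 2) choose d) \<ge> (2.59 + \<epsilon> d) ^ d)"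
    using eventually_choose_ge_power by (intro exI[of _ "\<lambda>_. 0"]) simp
qed

end
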